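(* Let $r$ be a positive integer and let $s,t$ be integers with $0\le s,t\le r-1$. Let $\gamma$ be the fractional part of $(s-\phi^{-1}(t+1))/r$ (so $0\le\gamma<1$). Let $h$ be the least positive integer with $r<\phi^h$ and $j=\lceil\gamma F_{h+2}\rceil$. If $h$ is even, let $w_L=jF_{h+1}\bmod F_{h+2}$ and $w_H=(j+1)F_{h+1}\bmod F_{h+2}$; if $h$ is odd, let $w_L=jF_h\bmod F_{h+2}$ and $w_H=(j-1)F_h\bmod F_{h+2}$ (least non-negative residues). Let $w=w_L$ if there is an integer $n$ with $\gamma<\phi^{-1}w_L-n<\gamma+1/r$, and $w=w_H$ otherwise. Put $v=wr+t$ and $u=G(v)$. Then $u$ and $v$ are non-negative integers with $u\equiv s\pmod r$, $v\equiv t\pmod r$, and $u=G(v)$.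
   Context: $F_0=0$, $F_1=1$, $F_i=F_{i-1}+F_{i-2}$ are the Fibonacci numbers and $\phi=(1+\sqrt5)/2$. Hofstadter's G function is $G(x)=\lfloor\phi^{-1}(x+1)\rfloor$ for integers $x\ge0$ (equivalently $G(0)=0$, $G(1)=1$, $G(x)=x-G(G(x-1))$). *)

theory Defs
  imports Complex_Main "HOL-Number_Theory.Cong" "HOL-Number_Theory.Fib"
begin

definition golden :: real where
  "golden = (1 + sqrt 5) / 2"

text \<open>Hofstadter's G function. It is only meant for arguments \<open>x \<ge> 0\<close>; the integer
  result type keeps the non-negativity of its values a genuine claim.\<close>

definition hofstadter_G :: "int \<Rightarrow> int" where
  "hofstadter_G x = \<lfloor>inverse golden * (of_int x + 1)\<rfloor>"

end

theory Submission
  imports Defs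
begin

text \<open>
  Write \<open>\<alpha> = 1/\<phi>\<close> and \<open>N = h + 2\<close>. Unfolding the floor, \<open>G(wr + t) \<equiv> s (mod r)\<close> says exactly
  that \<open>\<gamma> \<le> \<alpha>w - n < \<gamma> + 1/r\<close> for some integer \<open>n\<close>. Cassini's identity and
  \<open>\<alpha> F\<^sub>N = F\<^sub>N\<^sub>-\<^sub>1 - (-\<alpha>)\<^sup>N\<close> show that modulo 1 the number \<open>\<alpha>w\<^sub>L\<close> is \<open>j/F\<^sub>N\<close>, up to an error
  \<open>w\<^sub>L\<alpha>\<^sup>N/F\<^sub>N\<close> that is subtracted for even \<open>h\<close> and added for odd \<open>h\<close>; so \<open>w\<^sub>L\<close> can miss the interval
  on one known side only, and \<open>w\<^sub>H\<close> corrects by a step \<open>1/F\<^sub>N\<close> towards it. As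
  \<open>w\<^sub>L - w\<^sub>H \<le> F\<^sub>h\<close>, this correction is at most \<open>(1 + F\<^sub>h\<alpha>\<^sup>N)/F\<^sub>N = \<alpha>\<^sup>h < 1/r\<close>, hence it does not
  overshoot.
\<close>

section \<open>The inverse golden ratio \<alpha> and Fibonacci numbers\<close>

lemma inverse_golden_bounds: "0 < inverse golden" "inverse golden < 1"
proof -
  have "golden > 1" by (simp add: golden_def)
  then show "0 < inverse golden" "inverse golden < 1" by (auto intro: inverse_less_1_iff[THEN iffD2])
qed

lemma inverse_golden_squared: "(inverse golden)\<^sup>2 = 1 - inverse golden"
proof -
  have "golden\<^sup>2 = golden + 1" by (simp add: golden_def power2_eq_square field_simps)
  moreover have "golden > 1" by (simp add: golden_def)
  ultimately show ?thesis by (simp add: field_simps power2_eq_square)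
qed

text \<open>Since -\<alpha> is a root of x*x = x + 1, its powers obey the Fibonacci recurrence, so
  both sides obey it and only two initial values need checking.\<close>

lemma fib_Suc_mult_inverse_golden:
  "inverse golden * real (fib (Suc n)) = real (fib n) - (- inverse golden) ^ Suc n"
proof (induction n rule: fib.induct)
  case 2
  then show ?case using inverse_golden_squared by (simp add: power2_eq_square)
next
  case (3 n)
  let ?g = "inverse golden"
  have "(- ?g) ^ Suc (Suc (Suc n)) = (- ?g) ^ Suc n * (?g)\<^sup>2"
    by (simp add: power2_eq_square)
  also have "\<dots> = (- ?g) ^ Suc n + (- ?g) ^ Suc (Suc n)"
    unfolding inverse_golden_squared by (simp add: algebra_simps)
  finally have "(- ?g) ^ Suc (Suc (Suc n)) = (- ?g) ^ Suc n + (- ?g) ^ Suc (Suc n)" .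
  moreover have "fib (Suc (Suc (Suc n))) = fib (Suc (Suc n)) + fib (Suc n)"
    "fib (Suc (Suc n)) = fib (Suc n) + fib n" by simp_all
  ultimately show ?case using 3 by (simp only: distrib_left of_nat_add)
qed simp

text \<open>Each term is the mean of its two predecessors with weights \<alpha> and
  \<alpha>*\<alpha>, which sum to 1.\<close>

lemma fib_mult_inverse_golden_power_le_1: "real (fib n) * inverse golden ^ n \<le> 1"
proof (induction n rule: fib.induct)
  case 2
  then show ?case using inverse_golden_bounds by simp
next
  case (3 n)
  let ?g = "inverse golden"
  have "real (fib (Suc (Suc n))) * ?g ^ Suc (Suc n)
      = ?g * (real (fib (Suc n)) * ?g ^ Suc n) + ?g\<^sup>2 * (real (fib n) * ?g ^ n)"
    by (simp add: algebra_simps power2_eq_square)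
  also have "\<dots> \<le> ?g * 1 + ?g\<^sup>2 * 1"
    using 3 inverse_golden_bounds by (intro add_mono mult_left_mono) auto
  finally show ?case using inverse_golden_squared by simp
qed simp

text \<open>The same weighted recurrence governs both sides, the constant 1 being fixed by it. This
  evaluates the largest possible correction as exactly \<open>inverse golden ^ h\<close>.\<close>

lemma fib_add_2_mult_inverse_golden_power:
  "real (fib (n + 2)) * inverse golden ^ n = 1 + real (fib n) * inverse golden ^ (n + 2)"
proof (induction n rule: fib.induct)
  case 2
  let ?g = "inverse golden"
  have "?g ^ 3 = ?g * ?g\<^sup>2" by (simp add: power3_eq_cube power2_eq_square)
  also have "\<dots> = ?g - ?g\<^sup>2"
    by (subst (1) inverse_golden_squared) (simp add: algebra_simps power2_eq_square)
  finally show ?case using inverse_golden_squared by (simp add: numeral_3_eq_3 numeral_2_eq_2)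
next
  case (3 n)
  let ?g = "inverse golden"
  have "real (fib (Suc (Suc n) + 2)) * ?g ^ Suc (Suc n)
      = ?g * (real (fib (Suc n + 2)) * ?g ^ Suc n) + ?g\<^sup>2 * (real (fib (n + 2)) * ?g ^ n)"
    by (simp add: algebra_simps power2_eq_square)
  also have "\<dots> = (?g + ?g\<^sup>2) + ?g * (real (fib (Suc n)) * ?g ^ (Suc n + 2))
      + ?g\<^sup>2 * (real (fib n) * ?g ^ (n + 2))"
    unfolding 3 by (simp add: algebra_simps)
  also have "\<dots> = 1 + real (fib (Suc (Suc n))) * ?g ^ (Suc (Suc n) + 2)"
  proof -
    have "?g + ?g\<^sup>2 = 1" using inverse_golden_squared by simp
    then show ?thesis by (simp only:) (simp add: algebra_simps power2_eq_square)
  qed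
  finally show ?case .
qed simp

text \<open>An integral multiple \<open>q\<alpha>\<close> would make all \<open>q(\<alpha>F\<^sub>n\<^sub>+\<^sub>1 - F\<^sub>n)\<close> integers, but these are nonzero
  and tend to 0.\<close>

lemma inverse_golden_mult_notin_Ints:
  fixes q :: int
  assumes "q \<noteq> 0"
  shows "inverse golden * of_int q \<notin> \<int>"
proof
  let ?g = "inverse golden"
  assume "?g * of_int q \<in> \<int>"
  then obtain p where p: "?g * of_int q = real_of_int p" by (auto elim: Ints_cases)
  obtain n where n: "?g ^ n < 1 / \<bar>of_int q\<bar>"
    using real_arch_pow_inv[of "1 / \<bar>of_int q\<bar>" ?g] assms inverse_golden_bounds by auto
  have "of_int q * (- ?g) ^ Suc n = of_int q * (real (fib n) - ?g * real (fib (Suc n)))"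
    using fib_Suc_mult_inverse_golden[of n] by simp
  also have "\<dots> = of_int (q * int (fib n)) - (?g * of_int q) * real (fib (Suc n))"
    by (simp add: algebra_simps)
  also have "\<dots> = of_int (q * int (fib n) - p * int (fib (Suc n)))"
    by (simp add: p)
  finally obtain z :: int where eq: "of_int q * (- ?g) ^ Suc n = of_int z" by blast
  have "\<bar>of_int q * (- ?g) ^ Suc n\<bar> = \<bar>of_int q\<bar> * ?g ^ Suc n"
    using inverse_golden_bounds by (simp add: abs_mult power_abs)
  moreover have "\<dots> \<le> \<bar>of_int q\<bar> * ?g ^ n"
    using inverse_golden_bounds by (intro mult_left_mono power_decreasing) auto
  moreover have "\<bar>of_int q\<bar> * ?g ^ n < 1" using n assms by (simp add: field_simps)
  moreover have "of_int q * (- ?g) ^ Suc n \<noteq> 0" using assms inverse_golden_bounds by simp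
  ultimately have "\<bar>real_of_int z\<bar> < 1" "z \<noteq> 0" unfolding eq by auto
  then show False by linarith
qed

section \<open>Multiples of \<alpha> modulo 1 and residues modulo a Fibonacci number\<close>

lemma inverse_golden_mult_residue:
  fixes c j w :: int
  assumes w: "w = c mod int (fib (n + 2))"
    and c: "[c * int (fib (n + 1)) = j] (mod int (fib (n + 2)))"
  shows "\<exists>m::int. inverse golden * of_int w - of_int m
      = (of_int j - of_int w * (- inverse golden) ^ (n + 2)) / real (fib (n + 2))"
proof -
  let ?g = "inverse golden" and ?F = "real (fib (n + 2))"
  have "[w * int (fib (n + 1)) = c * int (fib (n + 1))] (mod int (fib (n + 2)))"
    unfolding w by (intro cong_mult) (auto simp: cong_def)
  with c have "[w * int (fib (n + 1)) = j] (mod int (fib (n + 2)))"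
    using cong_trans by blast
  \<comment> \<open>This quotient \<open>m\<close> is the integer to subtract from \<alpha>w: scaled
    by \<open>fib (n + 2)\<close>, the difference is j minus the power of -\<alpha> weighted by
    w.\<close>
  then obtain m where "w * int (fib (n + 1)) = j + int (fib (n + 2)) * m"
    by (metis cong_iff_lin cong_sym)
  then have m: "real_of_int w * real (fib (n + 1)) = of_int j + ?F * of_int m"
    by (metis of_int_add of_int_mult of_int_of_nat_eq)
  have F: "?F > 0" using fib_neq_0_nat[of "n + 2"] by (simp only: of_nat_0_less_iff)
  have "?g * ?F = real (fib (n + 1)) - (- ?g) ^ (n + 2)"
    using fib_Suc_mult_inverse_golden[of "n + 1"] by simp
  then have "of_int w * (?g * ?F) = of_int w * real (fib (n + 1)) - of_int w * (- ?g) ^ (n + 2)"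
    by (simp only: right_diff_distrib)
  then have "(?g * of_int w - of_int m) * ?F = of_int j - of_int w * (- ?g) ^ (n + 2)"
    unfolding m by (simp add: algebra_simps)
  then show ?thesis using F by (metis nonzero_eq_divide_eq less_irrefl)
qed

text \<open>By Cassini, \<open>fib (h + 1)\<close> is its own inverse for even h, which explains the
  multiplier in \<open>wL\<close> and \<open>wH\<close>.\<close>

lemma fib_square_cong:
  "[int (fib (n + 1)) * int (fib (n + 1)) = (- 1) ^ n] (mod int (fib (n + 2)))"
proof -
  have "int (fib (n + 1)) * int (fib (n + 1)) - (- 1) ^ n = int (fib (n + 2)) * int (fib n)"
    using fib_Cassini_int[of n] by (simp add: power2_eq_square)
  then show ?thesis by (simp only: cong_iff_dvd_diff dvd_triv_left)
qed

text \<open>As \<open>fib n\<close> is minus \<open>fib (n + 1)\<close> for this modulus, the sign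
  flips: for odd h the inverse of \<open>fib (h + 1)\<close> is \<open>fib h\<close>.\<close>

lemma fib_mult_fib_Suc_cong:
  "[int (fib n) * int (fib (n + 1)) = - ((- 1) ^ n)] (mod int (fib (n + 2)))"
proof -
  have "[int (fib n) * int (fib (n + 1)) = - (int (fib (n + 1)) * int (fib (n + 1)))]
      (mod int (fib (n + 2)))"
    by (simp add: cong_iff_dvd_diff add.commute flip: distrib_right)
  then show ?thesis using fib_square_cong[of n] cong_minus_minus_iff cong_trans by blast
qed

text \<open>Subtracting k either stays within the residues, giving equality, or wraps around to a
  residue that is still non-negative.\<close>

lemma mod_diff_ge:
  fixes a k m :: int
  assumes "0 \<le> k" "m > 0"
  shows "a mod m - k \<le> (a - k) mod m"
proof (cases "k \<le> a mod m")
  case True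
  then have "(a mod m - k) mod m = a mod m - k"
    using assms pos_mod_bound[of m a] by (intro mod_pos_pos_trivial) linarith+
  then show ?thesis by (simp add: mod_diff_left_eq)
next
  case False
  then show ?thesis using pos_mod_sign[of m "a - k"] assms by linarith
qed

section \<open>From the interval modulo 1 to the congruence for G\<close>

lemma hofstadter_G_cong:
  fixes r s t w n :: int
  assumes "r > 0"
    and "\<gamma> = frac ((of_int s - inverse golden * (of_int t + 1)) / of_int r)"
    and "\<gamma> \<le> inverse golden * of_int w - of_int n"
    and "inverse golden * of_int w - of_int n < \<gamma> + 1 / of_int r"
  shows "[hofstadter_G (w * r + t) = s] (mod r)"
proof -
  let ?g = "inverse golden"
  define x where "x = (of_int s - ?g * (of_int t + 1)) / of_int r"
  have r: "real_of_int r > 0" using assms(1) by simp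
  \<comment> \<open>Absorbing the floor of \<open>x\<close> into the integer replaces \<gamma> by
    \<open>x\<close> itself; scaling by r then gives a window of length 1, which fixes the
    floor.\<close>
  define m where "m = n - \<lfloor>x\<rfloor>"
  have xr: "x * of_int r = of_int s - ?g * (of_int t + 1)" using r by (simp add: x_def)
  have 1: "x \<le> ?g * of_int w - of_int m" "?g * of_int w - of_int m < x + 1 / of_int r"
    using assms(3,4) unfolding assms(2) x_def[symmetric] m_def frac_def by auto
  have "x * of_int r \<le> (?g * of_int w - of_int m) * of_int r"
    using 1(1) r by (intro mult_right_mono) auto
  moreover have "(?g * of_int w - of_int m) * of_int r < (x + 1 / of_int r) * of_int r"
    using 1(2) r by (intro mult_strict_right_mono) auto
  moreover have "(x + 1 / of_int r) * of_int r = x * of_int r + 1"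
    using r by (simp add: distrib_right)
  ultimately have "hofstadter_G (w * r + t) = s + m * r"
    unfolding hofstadter_G_def floor_eq_iff xr by (auto simp: algebra_simps)
  then show ?thesis by (simp add: cong_def)
qed

section \<open>Placing the two candidates for \<open>w\<close>\<close>

theorem theorem3:
  fixes r s t j wL wH w u v :: int and h :: nat and \<gamma> :: real
  assumes "r > 0"
    and "0 \<le> s" and "s \<le> r - 1"
    and "0 \<le> t" and "t \<le> r - 1"
    and "\<gamma> = frac ((of_int s - inverse golden * (of_int t + 1)) / of_int r)"
    and "h = (LEAST k. 0 < k \<and> of_int r < golden ^ k)"
    and "j = \<lceil>\<gamma> * of_nat (fib (h + 2))\<rceil>"
    and "wL = (if even h then (j * int (fib (h + 1))) mod int (fib (h + 2))
               else (j * int (fib h)) mod int (fib (h + 2)))"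
    and "wH = (if even h then ((j + 1) * int (fib (h + 1))) mod int (fib (h + 2))
               else ((j - 1) * int (fib h)) mod int (fib (h + 2)))"
    and "w = (if \<exists>n::int. \<gamma> < inverse golden * of_int wL - of_int n \<and>
                          inverse golden * of_int wL - of_int n < \<gamma> + 1 / of_int r
              then wL else wH)"
    and "v = w * r + t"
    and "u = hofstadter_G v"
  shows "u \<ge> 0 \<and> v \<ge> 0 \<and> [u = s] (mod r) \<and> [v = t] (mod r) \<and> u = hofstadter_G v"
proof -
  let ?g = "inverse golden" and ?F = "real (fib (h + 2))"
  define \<delta> where "\<delta> = ?g ^ (h + 2)"
  note g = inverse_golden_bounds
  have golden: "golden > 1" by (simp add: golden_def)
  have r: "real_of_int r > 0" using assms(1) by simp
  have Fn: "fib (h + 2) > 0" using fib_neq_0_nat by simp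
  then have F: "?F > 0" by (simp only: of_nat_0_less_iff)
  have \<delta>: "\<delta> > 0" using g by (simp add: \<delta>_def)

  \<comment> \<open>The least exponent h has its defining property only if some exponent does;
    \<open>Suc k\<close> also ensures positivity.\<close>
  obtain k where "of_int r < golden ^ k" using real_arch_pow[OF golden] by blast
  moreover have "golden ^ k \<le> golden ^ Suc k" using golden by (intro power_increasing) auto
  ultimately have "0 < Suc k \<and> of_int r < golden ^ Suc k" by simp
  then have "of_int r < golden ^ h" unfolding assms(7) by (rule LeastI2) blast
  then have r_h: "?g ^ h < 1 / of_int r" using r golden by (simp add: field_simps power_inverse)
  have step: "1 / ?F + real (fib h) * \<delta> / ?F = ?g ^ h"
    using fib_add_2_mult_inverse_golden_power[of h] F
    by (simp only: \<delta>_def add_divide_distrib[symmetric] nonzero_divide_eq_eq mult.commute)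
  have inv_F: "1 / ?F \<le> ?g ^ h" using step \<delta> F by (simp flip: step)
  have \<delta>F: "\<delta> * ?F \<le> 1" using fib_mult_inverse_golden_power_le_1[of "h + 2"] by (simp add: \<delta>_def mult.commute)
  have \<delta>_r: "\<delta> < 1 / of_int r"
  proof -
    have "\<delta> \<le> ?g ^ h" unfolding \<delta>_def using g by (intro power_decreasing) auto
    with r_h show ?thesis by simp
  qed

  \<comment> \<open>Irrationality of \<alpha> makes the ceiling strict, so j/F lies strictly above
    \<gamma>; otherwise a nonzero multiple of \<alpha> would be an integer.\<close>
  have \<gamma>F: "\<gamma> * ?F \<notin> \<int>"
  proof
    assume "\<gamma> * ?F \<in> \<int>"
    define x where "x = (of_int s - ?g * (of_int t + 1)) / of_int r"
    have xr: "x * of_int r = of_int s - ?g * (of_int t + 1)" using r by (simp add: x_def)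
    have "x * ?F = \<gamma> * ?F + of_int \<lfloor>x\<rfloor> * ?F"
      unfolding assms(6) x_def[symmetric] frac_def by (simp add: algebra_simps)
    then have "x * ?F \<in> \<int>" using \<open>\<gamma> * ?F \<in> \<int>\<close> by simp
    moreover have "?g * of_int ((t + 1) * int (fib (h + 2))) = of_int s * ?F - x * ?F * of_int r"
    proof -
      have "x * ?F * of_int r = (of_int s - ?g * (of_int t + 1)) * ?F" by (simp flip: xr)
      then show ?thesis by (simp add: algebra_simps)
    qed
    ultimately have "?g * of_int ((t + 1) * int (fib (h + 2))) \<in> \<int>" by simp
    moreover have "(t + 1) * int (fib (h + 2)) \<noteq> 0" using assms(4) Fn by (simp del: fib.simps add_2_eq_Suc')
    ultimately show False using inverse_golden_mult_notin_Ints by blast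
  qed
  have "\<gamma> * ?F \<noteq> of_int j" using \<gamma>F by (metis Ints_of_int)
  then have "\<gamma> * ?F < of_int j" "of_int j - 1 < \<gamma> * ?F" unfolding assms(8) by linarith+
  then have j: "\<gamma> < of_int j / ?F" "of_int j / ?F < \<gamma> + 1 / ?F"
    by (simp_all only: pos_less_divide_eq[OF F] pos_divide_less_eq[OF F] diff_divide_distrib[symmetric]
        less_diff_eq[symmetric] flip: diff_less_eq)

  have wL: "0 \<le> wL" "wL < int (fib (h + 2))" and wH: "0 \<le> wH" "wH < int (fib (h + 2))"
    unfolding assms(9,10) using Fn by auto
  have err: "0 \<le> of_int x * \<delta> / ?F" "of_int x * \<delta> / ?F \<le> \<delta>" "of_int x * \<delta> / ?F \<le> 1 / ?F"
    if "0 \<le> x" "x < int (fib (h + 2))" for x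
  proof -
    have "real_of_int x \<le> ?F" using that by linarith
    then have le: "of_int x * \<delta> \<le> \<delta> * ?F" using \<delta> by (simp add: mult.commute)
    show "0 \<le> of_int x * \<delta> / ?F" using that \<delta> by simp
    show "of_int x * \<delta> / ?F \<le> \<delta>" using le by (simp only: pos_divide_le_eq[OF F])
    show "of_int x * \<delta> / ?F \<le> 1 / ?F"
      using le \<delta>F F by (intro divide_right_mono) linarith+
  qed

  \<comment> \<open>For even h, adding \<open>fib (h + 1)\<close> amounts to subtracting
    \<open>fib h\<close> modulo \<open>fib (h + 2)\<close>; for odd h, \<open>fib h\<close> is
    subtracted directly.\<close>
  have "wL - int (fib h) \<le> wH"
  proof (cases "even h")
    case True
    have "(j + 1) * int (fib (h + 1)) = j * int (fib (h + 1)) - int (fib h) + int (fib (h + 2))"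
      by (simp add: algebra_simps)
    then have "wH = (j * int (fib (h + 1)) - int (fib h)) mod int (fib (h + 2))"
      using True assms(10) by (metis mod_add_self2)
    then show ?thesis using True assms(9) mod_diff_ge[of "int (fib h)"] Fn
      by (simp only: if_True of_nat_0_less_iff of_nat_0_le_iff)
  next
    case False
    then show ?thesis using assms(9,10) mod_diff_ge[of "int (fib h)"] Fn
      by (simp only: if_False left_diff_distrib mult_1_left of_nat_0_less_iff of_nat_0_le_iff)
  qed
  then have "real_of_int wL - of_int wH \<le> real (fib h)" by linarith
  then have "(of_int wL - of_int wH) * \<delta> / ?F \<le> real (fib h) * \<delta> / ?F"
    using \<delta> F by (intro divide_right_mono mult_right_mono) auto
  \<comment> \<open>The left side is the shift modulo 1 from \<open>wL\<close> to \<open>wH\<close>: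
    upwards for even h, downwards for odd h.\<close>
  then have diff: "1 / ?F + of_int wL * \<delta> / ?F - of_int wH * \<delta> / ?F < 1 / of_int r"
    using step r_h by (simp add: left_diff_distrib diff_divide_distrib)

  have "\<exists>n::int. \<gamma> \<le> ?g * of_int w - of_int n \<and> ?g * of_int w - of_int n < \<gamma> + 1 / of_int r"
  proof (cases "\<exists>n::int. \<gamma> < ?g * of_int wL - of_int n \<and>
      ?g * of_int wL - of_int n < \<gamma> + 1 / of_int r")
    case True
    then have "w = wL" using assms(11) by (simp only: if_True)
    with True show ?thesis by (blast intro: less_imp_le)
  next
    case False
    then have w: "w = wH" and miss: "\<not> (\<gamma> < ?g * of_int wL - of_int n \<and>
      ?g * of_int wL - of_int n < \<gamma> + 1 / of_int r)" for n :: int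
      using assms(11) by (simp only: if_False, blast)
    show ?thesis
    proof (cases "even h")
      case True
      have c: "[i * int (fib (h + 1)) * int (fib (h + 1)) = i] (mod int (fib (h + 2)))" for i
        using cong_scalar_left[OF fib_square_cong[of h], of i] True by (simp add: mult.assoc)
      have e: "(- ?g) ^ (h + 2) = \<delta>" using True by (simp add: \<delta>_def)
      obtain n where n: "?g * of_int wL - of_int n = (of_int j - of_int wL * \<delta>) / ?F"
        using inverse_golden_mult_residue[OF _ c, of wL j] assms(9) True unfolding e by (simp only: if_True) blast
      obtain m where m: "?g * of_int wH - of_int m = (of_int (j + 1) - of_int wH * \<delta>) / ?F"
        using inverse_golden_mult_residue[OF _ c, of wH "j + 1"] assms(10) True unfolding e by (simp only: if_True) blast
      have "?g * of_int wL - of_int n = of_int j / ?F - of_int wL * \<delta> / ?F"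
        by (simp add: n diff_divide_distrib)
      moreover have "?g * of_int wH - of_int m = of_int j / ?F + 1 / ?F - of_int wH * \<delta> / ?F"
        by (simp add: m diff_divide_distrib add_divide_distrib)
      \<comment> \<open>The value for \<open>wL\<close> is below \<gamma> + 1/r, so a miss puts it
        at or below \<gamma>, and \<open>diff\<close> bounds the new value above. From below, the
        error is at most the added 1/F.\<close>
      ultimately have "\<gamma> \<le> ?g * of_int wH - of_int m \<and> ?g * of_int wH - of_int m < \<gamma> + 1 / of_int r"
        using miss[of n] j diff err[OF wL] err[OF wH] inv_F r_h by linarith
      then show ?thesis unfolding w by blast
    next
      case False
      have c: "[i * int (fib h) * int (fib (h + 1)) = i] (mod int (fib (h + 2)))" for i
        using cong_scalar_left[OF fib_mult_fib_Suc_cong[of h], of i] False by (simp add: mult.assoc)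
      have e: "(- ?g) ^ (h + 2) = - \<delta>" using False by (simp add: \<delta>_def)
      obtain n where n: "?g * of_int wL - of_int n = (of_int j + of_int wL * \<delta>) / ?F"
        using inverse_golden_mult_residue[OF _ c, of wL j] assms(9) False unfolding e by (simp only: if_False mult_minus_right diff_minus_eq_add) blast
      obtain m where m: "?g * of_int wH - of_int m = (of_int (j - 1) + of_int wH * \<delta>) / ?F"
        using inverse_golden_mult_residue[OF _ c, of wH "j - 1"] assms(10) False unfolding e by (simp only: if_False mult_minus_right diff_minus_eq_add) blast
      have "?g * of_int wL - of_int n = of_int j / ?F + of_int wL * \<delta> / ?F"
        by (simp add: n add_divide_distrib)
      moreover have "?g * of_int wH - of_int m = of_int j / ?F - 1 / ?F + of_int wH * \<delta> / ?F"
        by (simp add: m diff_divide_distrib add_divide_distrib)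
      \<comment> \<open>Here \<open>wL\<close> lies above \<gamma>, so a miss means at least
        \<gamma> + 1/r, and \<open>diff\<close> keeps the new value above \<gamma>. From above, (j -
        1)/F is below \<gamma> and the error is at most \<delta> < 1/r.\<close>
      ultimately have "\<gamma> \<le> ?g * of_int wH - of_int m \<and> ?g * of_int wH - of_int m < \<gamma> + 1 / of_int r"
        using miss[of n] j diff err[OF wL] err[OF wH] \<delta>_r by linarith
      then show ?thesis unfolding w by blast
    qed
  qed
  then have u: "[u = s] (mod r)"
    unfolding assms(12,13) using hofstadter_G_cong[OF assms(1,6)] by blast
  have "w \<ge> 0" using wL wH assms(11) by (auto split: if_splits)
  then have v: "v \<ge> 0" using assms(1,4,12) by simp
  then have "u \<ge> 0" unfolding assms(13) hofstadter_G_def using g by simp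
  moreover have "[v = t] (mod r)" by (simp add: assms(12) cong_def)
  ultimately show ?thesis using u v assms(13) by blast
qed

end
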